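(* Let $\mathcal{R}$ be a unital ring with involution, let $m\in\mathcal{R}$ be invertible with $m^*=m$, and let $a,b\in\mathcal{R}^{\mathrm{core},m}$. If $a^{*}mb=0$ and $ab=0$, then $a+b\in\mathcal{R}^{\mathrm{core},m}$ and $$(a+b)^{\mathrm{core},m}=(1-b^{\mathrm{core},m}b)\,a^{\mathrm{core},m}+b^{\mathrm{core},m}.$$
   Context: $\mathcal{R}$ is a (not necessarily commutative) unital ring with an involution $x\mapsto x^*$ satisfying $(xy)^*=y^*x^*$, $(x+y)^*=x^*+y^*$, $(x^* )^*=x$. For an invertible $m\in\mathcal{R}$ with $m^*=m$, an element $z\in\mathcal{R}$ is the $m$-weighted core inverse of $a\in\mathcal{R}$ if $aza=a$, $z\mathcal{R}=a\mathcal{R}$ and $\mathcal{R}z=\mathcal{R}a^*m$. It is unique if it exists and is denoted $a^{\mathrm{core},m}$; $\mathcal{R}^{\mathrm{core},m}$ is the set of elements that have an $m$-weighted core inverse. *)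

theory Defs
  imports Main
begin

(* ring + monoid_mult rather than ring_1: the zero ring (1 = 0) is not excluded. *)
class star_ring = ring + monoid_mult +
  fixes star :: "'a \<Rightarrow> 'a"
  assumes star_mult: "star (x * y) = star y * star x"
    and star_add: "star (x + y) = star x + star y"
    and star_star: "star (star x) = x"

(* Two-sided: m dvd 1 would only give a right inverse in a noncommutative ring. *)
definition invertible_elem :: "'a::star_ring \<Rightarrow> bool" where
  "invertible_elem m \<longleftrightarrow> (\<exists>n. m * n = 1 \<and> n * m = 1)"

definition right_ideal_of :: "'a::star_ring \<Rightarrow> 'a set" where
  "right_ideal_of x = {x * r | r. True}"

definition left_ideal_of :: "'a::star_ring \<Rightarrow> 'a set" where
  "left_ideal_of x = {r * x | r. True}"

definition is_weighted_core_inverse :: "'a::star_ring \<Rightarrow> 'a \<Rightarrow> 'a \<Rightarrow> bool" where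
  "is_weighted_core_inverse m a z \<longleftrightarrow>
     a * z * a = a \<and>
     right_ideal_of z = right_ideal_of a \<and>
     left_ideal_of z = left_ideal_of (star a * m)"

definition weighted_core_invertibles :: "'a::star_ring \<Rightarrow> 'a set" where
  "weighted_core_invertibles m = {a. \<exists>z. is_weighted_core_inverse m a z}"

(* Only meaningful for a in weighted_core_invertibles m with m invertible and star m = m;
   see is_weighted_core_inverse_unique. *)
definition weighted_core_inverse :: "'a::star_ring \<Rightarrow> 'a \<Rightarrow> 'a" where
  "weighted_core_inverse m a = (THE z. is_weighted_core_inverse m a z)"

lemma star_one: "star (1::'a::star_ring) = 1"
  by (metis mult.left_neutral mult.right_neutral star_mult star_star)

lemma star_mult3: "star (x * y * w :: 'a::star_ring) = star w * star y * star x"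
  by (simp add: star_mult mult.assoc)

lemma star_inverse:
  fixes m n :: "'a::star_ring"
  assumes "star m = m" "m * n = 1" "n * m = 1"
  shows "star n = n"
proof -
  have "star n * m = 1"
    using assms(1,2) star_mult[of m n] by (simp only: star_one)
  then have "star n * m * n = n" by simp
  then show ?thesis using assms by (simp add: mult.assoc)
qed

lemma is_weighted_core_inverse_props:
  fixes m n a z :: "'a::star_ring"
  assumes m: "star m = m" and n: "m * n = 1" "n * m = 1" and z: "is_weighted_core_inverse m a z"
  shows "a * z * a = a" "z * a * z = z" "star (m * a * z) = m * a * z" "z * a * a = a" "a * z * z = z"
proof -
  show aza: "a * z * a = a" using z by (simp add: is_weighted_core_inverse_def)
  have "z * 1 \<in> right_ideal_of a" "a * 1 \<in> right_ideal_of z"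
    using z unfolding is_weighted_core_inverse_def right_ideal_of_def by blast+
  then obtain u v where u: "z = a * u" and v: "a = z * v"
    by (auto simp: right_ideal_of_def)
  have "1 * z \<in> left_ideal_of (star a * m)"
    using z unfolding is_weighted_core_inverse_def left_ideal_of_def by blast
  then obtain s where s: "z = s * star a * m"
    by (auto simp: left_ideal_of_def mult.assoc)
  let ?p = "m * a * z"
  have sa: "star a = star a * star z * star a"
    using arg_cong[OF aza, of star] by (simp add: star_mult mult.assoc)
  have sp: "star ?p = star z * star a * m" using m by (simp add: star_mult mult.assoc)
  have zn: "z * n = s * star a" by (simp add: s mult.assoc n)
  have "z = s * (star a * star z * star a) * m" using s sa by simp
  also have "\<dots> = (s * star a) * (star z * star a * m)" by (simp add: mult.assoc)
  also have "\<dots> = z * n * star ?p" by (simp only: zn sp)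
  finally have zz: "z = z * n * star ?p" .
  from arg_cong[OF this, of "\<lambda>x. m * a * x"]
  have e: "?p = ?p * n * star ?p" by (simp only: mult.assoc)
  have "star (?p * n * star ?p) = ?p * n * star ?p"
    by (simp only: star_mult3[of ?p n] star_star star_inverse[OF m n])
  with e show sym: "star ?p = ?p" by metis
  have "z = z * n * ?p" using zz sym by simp
  also have "\<dots> = z * (n * m) * a * z" by (simp only: mult.assoc)
  finally show zaz: "z * a * z = z" using n by simp
  show "z * a * a = a" using zaz v by (metis mult.assoc)
  show "a * z * z = z" using aza u by (metis mult.assoc)
qed

lemma is_weighted_core_inverse_unique:
  fixes m a z z' :: "'a::star_ring"
  assumes inv: "invertible_elem m" and m: "star m = m"
    and z: "is_weighted_core_inverse m a z" and z': "is_weighted_core_inverse m a z'"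
  shows "z = z'"
proof -
  obtain n where n: "m * n = 1" "n * m = 1"
    using inv by (auto simp: invertible_elem_def)
  note p = is_weighted_core_inverse_props[OF m n z] and p' = is_weighted_core_inverse_props[OF m n z']
  let ?p = "m * a * z" and ?q = "m * a * z'"
  have "?p * n * ?q = m * a * z * (n * m) * a * z'" by (simp only: mult.assoc)
  also have "\<dots> = m * (a * z * a) * z'" using n by (simp add: mult.assoc)
  finally have pq: "?p * n * ?q = ?q" using p(1) by simp
  have "?q * n * ?p = m * a * z' * (n * m) * a * z" by (simp only: mult.assoc)
  also have "\<dots> = m * (a * z' * a) * z" using n by (simp add: mult.assoc)
  finally have qp: "?q * n * ?p = ?p" using p'(1) by simp
  have "star (?p * n * ?q) = ?q * n * ?p"
    by (simp only: star_mult3[of ?p n] star_inverse[OF m n] p(3) p'(3))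
  with pq qp p'(3) have "?q = ?p" by simp
  then have "n * ?q = n * ?p" by simp
  then have "(n * m) * (a * z') = (n * m) * (a * z)" by (simp only: mult.assoc)
  then have eq: "a * z' = a * z" using n by simp
  have "z = z * (a * z')" using p(2) eq by (simp add: mult.assoc)
  also have "\<dots> = z * (a * (a * z' * z'))" using p'(5) by simp
  also have "\<dots> = (z * a * a) * z' * z'" by (simp only: mult.assoc)
  finally show ?thesis using p(4) p'(5) by simp
qed

lemma weighted_core_inverse_eqI:
  fixes m a z :: "'a::star_ring"
  assumes "invertible_elem m" "star m = m" "is_weighted_core_inverse m a z"
  shows "weighted_core_inverse m a = z"
  unfolding weighted_core_inverse_def
  using assms is_weighted_core_inverse_unique by blast

end

theory Submission
  imports Defs
begin

text \<open>
  Write \<open>x\<close>, \<open>y\<close> for the weighted core inverses of \<open>a\<close>, \<open>b\<close>. An element \<open>z\<close> is the weighted core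
  inverse of \<open>c\<close> as soon as it satisfies four equations that can be checked once the products
  \<open>c * z\<close> and \<open>z * c\<close> are known (\<open>is_weighted_core_inverseI\<close>). For \<open>c = a + b\<close> and
  \<open>z = (1 - y * b) * x + y\<close> these products are short because the two summands are orthogonal: since
  \<open>x\<close> is a left multiple of \<open>star a * m\<close> and \<open>y\<close> one of \<open>star b * m\<close>, the condition
  \<open>star a * m * b = 0\<close> and its adjoint \<open>star b * m * a = 0\<close> give \<open>x * b = 0\<close> and \<open>y * a = 0\<close>;
  since \<open>x \<in> a\<R>\<close> and \<open>y \<in> b\<R>\<close>, also \<open>x * y = 0\<close>, \<open>y * x = 0\<close> and, from \<open>a * b = 0\<close>, \<open>a * y = 0\<close>.

  The term \<open>- y * b * x\<close> is the correction to the naive guess \<open>x + y\<close> forced by \<open>b * a\<close>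
  possibly being nonzero: it cancels the unwanted term \<open>b * x\<close> of \<open>c * (x + y)\<close>, leaving
  \<open>c * z = a * x + b * y\<close>, so that \<open>m * c * z\<close> is self-adjoint.
\<close>

lemma star_zero: "star (0::'a::star_ring) = 0"
  using star_add[of "0::'a" 0] by simp

text \<open>
  A converse to \<open>is_weighted_core_inverse_props\<close>. The equations \<open>z = c * z * z\<close> and \<open>c = z * c * c\<close>
  exhibit each element in the right ideal of the other. For the left ideals, the equation
  \<open>m * c * z = star z * star c * m\<close> carries a factor \<open>z\<close> on the right into a factor
  \<open>star c * m\<close> and back.
\<close>

lemma is_weighted_core_inverseI:
  fixes m c z :: "'a::star_ring"
  assumes inv: "invertible_elem m" and m: "star m = m"
    and czc: "c * z * c = c" and zcc: "z * c * c = c" and czz: "c * z * z = z"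
    and sym: "star (m * (c * z)) = m * (c * z)"
  shows "is_weighted_core_inverse m c z"
proof -
  obtain n where n: "n * m = 1"
    using inv by (auto simp: invertible_elem_def)
  have zcz: "z * c * z = z"
    using zcc czz by (metis mult.assoc)
  have sym': "star z * star c * m = m * (c * z)"
    using sym m by (simp add: star_mult)
  have "z = z * (n * m) * c * z"
    using zcz n by simp
  also have "\<dots> = z * n * (m * (c * z))" by (simp only: mult.assoc)
  also have "\<dots> = z * n * star z * (star c * m)"
    by (simp only: sym'[symmetric] mult.assoc)
  finally have z_left: "z = z * n * star z * (star c * m)" .
  have "star c * m = star (c * z * c) * m"
    using czc by simp
  also have "\<dots> = star c * (star z * star c * m)"
    by (simp add: star_mult mult.assoc)
  also have "\<dots> = star c * (m * (c * z))"
    by (simp only: sym')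
  also have "\<dots> = star c * m * c * z"
    by (simp only: mult.assoc)
  finally have c_left: "star c * m = star c * m * c * z" .
  have "right_ideal_of z = right_ideal_of c"
    unfolding right_ideal_of_def using zcc czz by safe (metis mult.assoc)+
  moreover have "left_ideal_of z = left_ideal_of (star c * m)"
    unfolding left_ideal_of_def using z_left c_left by safe (metis mult.assoc)+
  ultimately show ?thesis
    using czc by (simp add: is_weighted_core_inverse_def)
qed

lemma weighted_core_inverse_mult_eq_0:
  fixes m a x d :: "'a::star_ring"
  assumes x: "is_weighted_core_inverse m a x" and d: "star a * m * d = 0"
  shows "x * d = 0"
proof -
  have "1 * x \<in> left_ideal_of (star a * m)"
    using x unfolding is_weighted_core_inverse_def left_ideal_of_def by blast
  then obtain s where "x = s * (star a * m)"
    by (auto simp: left_ideal_of_def)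
  then have "x * d = s * (star a * m * d)" by (simp only: mult.assoc)
  then show ?thesis using d by simp
qed

theorem theorem3p2:
  fixes m a b :: "'a::star_ring"
  assumes "invertible_elem m"
    and "star m = m"
    and "a \<in> weighted_core_invertibles m"
    and "b \<in> weighted_core_invertibles m"
    and "star a * m * b = 0"
    and "a * b = 0"
  shows "a + b \<in> weighted_core_invertibles m \<and>
         weighted_core_inverse m (a + b) =
           (1 - weighted_core_inverse m b * b) * weighted_core_inverse m a + weighted_core_inverse m b"
proof -
  obtain n where n: "m * n = 1" "n * m = 1"
    using assms(1) by (auto simp: invertible_elem_def)
  obtain x y where x: "is_weighted_core_inverse m a x" and y: "is_weighted_core_inverse m b y"
    using assms(3,4) by (auto simp: weighted_core_invertibles_def)
  note px = is_weighted_core_inverse_props[OF assms(2) n x]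
    and py = is_weighted_core_inverse_props[OF assms(2) n y]
  have "star b * m * a = star (star a * m * b)"
    using assms(2) by (simp add: star_mult star_star mult.assoc)
  then have bma: "star b * m * a = 0"
    using assms(5) by (simp add: star_zero)
  have xb: "x * b = 0" and ya: "y * a = 0"
    using weighted_core_inverse_mult_eq_0 x y assms(5) bma by blast+
  have ay: "a * y = 0"
    using py(5) assms(6) by (metis mult.assoc mult_zero_left)
  have xy: "x * y = 0"
    using py(5) xb by (metis mult.assoc mult_zero_left)
  have yx: "y * x = 0"
    using px(5) ya by (metis mult.assoc mult_zero_left)
  define c where "c = a + b"
  define z where "z = (1 - y * b) * x + y"
  have "c * z = a * x - (a * y) * b * x + a * y + b * x - (b * y * b) * x + b * y"
    by (simp add: c_def z_def algebra_simps)
  then have cz: "c * z = a * x + b * y"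
    using ay py(1) by simp
  have "z * c = x * a + x * b - y * b * x * a - y * b * (x * b) + y * a + y * b"
    by (simp add: c_def z_def algebra_simps)
  then have zc: "z * c = x * a - y * b * x * a + y * b"
    using xb ya by simp
  have "is_weighted_core_inverse m c z"
  proof (rule is_weighted_core_inverseI[OF assms(1,2)])
    have "c * z * c = a * x * a + a * (x * b) + b * (y * a) + b * y * b"
      unfolding cz by (simp add: c_def algebra_simps)
    then show "c * z * c = c"
      using px(1) py(1) xb ya by (simp add: c_def)
    have "z * c * c = x * a * a + x * (a * b) - y * b * (x * a * a) - y * b * x * (a * b)
        + y * b * a + y * b * b"
      unfolding zc by (simp add: c_def algebra_simps)
    then show "z * c * c = c"
      using px(4) py(4) assms(6) by (simp add: c_def)
    have z_eq: "z = x - y * b * x + y"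
      by (simp add: z_def algebra_simps)
    have "c * z * z = a * x * x - a * (x * y) * b * x + a * (x * y)
        + b * (y * x) - (b * y * y) * b * x + b * y * y"
      unfolding cz unfolding z_eq by (simp add: algebra_simps)
    then show "c * z * z = z"
      using px(5) py(5) xy yx by (simp add: z_eq)
    show "star (m * (c * z)) = m * (c * z)"
      unfolding cz using px(3) py(3) by (simp add: distrib_left star_add mult.assoc)
  qed
  then show ?thesis
    using weighted_core_inverse_eqI[OF assms(1,2)] x y
    by (auto simp: weighted_core_invertibles_def c_def z_def)
qed

end
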